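(* Let $e\in\mathfrak{osp}(m|2n)_{\bar0}$ be nilpotent with orthosymplectic partition $(p|q)$, $p=(p_1\ge\cdots\ge p_r)$, $q=(q_1\ge\cdots\ge q_s)$. Then $\dim\mathfrak{osp}(m|2n)^e_{\bar1}=\sum_{i=1}^r\sum_{j=1}^s\min(p_i,q_j)$, which is half of $\dim\mathfrak{gl}(m|2n)^e_{\bar1}$.
   Context: $\mathfrak{osp}(m|2n)\subset\mathfrak{gl}(m|2n)=\mathrm{End}(V_0\oplus V_1)$ is the subalgebra preserving a nondegenerate supersymmetric form $\varphi$ ($V_0\perp V_1$, symmetric on $V_0$, skew on $V_1$): $\mathfrak{osp}(m|2n)_i=\{z\in\mathfrak{gl}(m|2n)_i\mid\varphi(zx,y)=-(-1)^{i\deg x}\varphi(x,zy)\}$. The partition $(p|q)$ consists of the Jordan types of $e|_{V_0}$ and $e|_{V_1}$; $\mathfrak{g}^e$ is the centralizer of $e$. *)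

theory Defs
  imports "HOL-Analysis.Analysis"
begin

text \<open>Complex vector space structure on matrices (entrywise scalar multiplication),
  so that dimensions of subspaces of gl(m|2n) are complex dimensions.\<close>

definition mscale :: "'a::field \<Rightarrow> 'a^'n::finite^'m::finite \<Rightarrow> 'a^'n^'m" where
  "mscale c A = (\<chi> i j. c * A$i$j)"

interpretation mat: vector_space "mscale :: 'a::field \<Rightarrow> 'a^'n::finite^'m::finite \<Rightarrow> 'a^'n^'m"
  by unfold_locales (vector mscale_def algebra_simps)+

text \<open>The superspace V = V_0 \<oplus> V_1 has basis indexed by 'a + 'b:
  Inl indices span V_0 (dimension m = CARD('a)), Inr indices span V_1 (dimension CARD('b) = 2n).\<close>

fun par :: "'a + 'b \<Rightarrow> nat" where
  "par (Inl _) = 0" | "par (Inr _) = 1"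

text \<open>Homogeneous vectors of degree d, and homogeneous endomorphisms of degree i
  (i.e. elements of gl(m|2n)_i).\<close>
definition homog_vec :: "nat \<Rightarrow> complex^('a::finite+'b::finite) \<Rightarrow> bool" where
  "homog_vec d x \<longleftrightarrow> (\<forall>k. par k \<noteq> d \<longrightarrow> x$k = 0)"

definition gl_part :: "nat \<Rightarrow> (complex^('a::finite+'b::finite)^('a::finite+'b::finite)) set" where
  "gl_part i = {z. \<forall>r c. (par r + par c) mod 2 \<noteq> i \<longrightarrow> z$r$c = 0}"

text \<open>Bilinear form with Gram matrix G: phi(x,y) = x^T G y (complex bilinear).\<close>
definition bform :: "complex^('a::finite+'b::finite)^('a::finite+'b::finite) \<Rightarrow> complex^('a::finite+'b::finite) \<Rightarrow> complex^('a::finite+'b::finite) \<Rightarrow> complex" where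
  "bform G x y = (\<Sum>r\<in>UNIV. \<Sum>c\<in>UNIV. x$r * G$r$c * y$c)"

text \<open>Nondegenerate supersymmetric form: V_0 \<perp> V_1, symmetric on V_0, skew on V_1, nondegenerate.\<close>
definition supersym_form :: "complex^('a::finite+'b::finite)^('a::finite+'b::finite) \<Rightarrow> bool" where
  "supersym_form G \<longleftrightarrow>
     (\<forall>r c. par r \<noteq> par c \<longrightarrow> G$r$c = 0) \<and>
     (\<forall>i j. G$(Inl i)$(Inl j) = G$(Inl j)$(Inl i)) \<and>
     (\<forall>i j. G$(Inr i)$(Inr j) = - G$(Inr j)$(Inr i)) \<and>
     invertible G"

text \<open>osp(m|2n)_i for the form with Gram matrix G.\<close>
definition osp_part :: "complex^('a::finite+'b::finite)^('a::finite+'b::finite) \<Rightarrow> nat \<Rightarrow> (complex^('a::finite+'b::finite)^('a::finite+'b::finite)) set" where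
  "osp_part G i = {z \<in> gl_part i. \<forall>d x y. d \<in> {0,1} \<longrightarrow> homog_vec d x \<longrightarrow>
      bform G (z *v x) y = - ((-1) ^ (i * d)) * bform G x (z *v y)}"

text \<open>Supercommutator of homogeneous elements of degrees i and j.\<close>
definition sbracket :: "nat \<Rightarrow> nat \<Rightarrow> complex^'n::finite^'n \<Rightarrow> complex^'n::finite^'n \<Rightarrow> complex^'n::finite^'n" where
  "sbracket i j x y = x ** y - ((-1) ^ (i * j)) *\<^sub>R (y ** x)"

text \<open>Odd part of the centralizer of an even element e in a homogeneous subspace S.\<close>
definition odd_centralizer :: "complex^'n::finite^'n \<Rightarrow> (complex^'n::finite^'n) set \<Rightarrow> (complex^'n::finite^'n) set" where
  "odd_centralizer e S = {z \<in> S. sbracket 0 1 e z = 0}"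

definition nilpotent_mat :: "complex^'n::finite^'n \<Rightarrow> bool" where
  "nilpotent_mat N \<longleftrightarrow> (\<exists>k. ((\<lambda>A. N ** A) ^^ k) (mat 1) = 0)"

text \<open>Blocks of e restricted to V_0 and V_1.\<close>
definition blk0 :: "complex^('a::finite+'b::finite)^('a::finite+'b::finite) \<Rightarrow> complex^'a::finite^'a" where
  "blk0 e = (\<chi> i j. e$(Inl i)$(Inl j))"
definition blk1 :: "complex^('a::finite+'b::finite)^('a::finite+'b::finite) \<Rightarrow> complex^'b^'b" where
  "blk1 e = (\<chi> i j. e$(Inr i)$(Inr j))"

text \<open>Jordan type of a nilpotent N: p is a non-increasing list of positive integers and
  there is a basis consisting of Jordan chains v i 0, ..., v i (p_i - 1) with
  N (v i k) = v i (k+1) and N (v i (p_i - 1)) = 0.\<close>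
definition jordan_type :: "complex^'c::finite^'c \<Rightarrow> nat list \<Rightarrow> bool" where
  "jordan_type N p \<longleftrightarrow> sorted (rev p) \<and> (\<forall>x \<in> set p. 0 < x) \<and>
     (\<exists>v :: nat \<Rightarrow> nat \<Rightarrow> complex^'c.
        let S = {(i,k). i < length p \<and> k < p!i} in
        (\<forall>(i,k) \<in> S. N *v v i k = (if Suc k < p!i then v i (Suc k) else 0)) \<and>
        inj_on (\<lambda>(i,k). v i k) S \<and>
        \<not> vec.dependent ((\<lambda>(i,k). v i k) ` S) \<and>
        vec.span ((\<lambda>(i,k). v i k) ` S) = UNIV)"

end

theory Submission
  imports Defs
begin

text \<open>
  Let \<open>e\<close> be an even nilpotent element of \<open>osp(m|2n)\<close> with Jordan types \<open>p\<close> on \<open>V\<^sub>0\<close> and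
  \<open>q\<close> on \<open>V\<^sub>1\<close>.  Writing matrices in block form for \<open>V = V\<^sub>0 \<oplus> V\<^sub>1\<close>, the form is
  \<open>diag(G0, G1)\<close>, \<open>e = diag(e0, e1)\<close>, and an odd element is \<open>z = [0 C; B 0]\<close>.  Then:

  \<^item> \<open>z\<close> commutes with \<open>e\<close> iff \<open>B\<close> intertwines \<open>e0 \<rightarrow> e1\<close> and \<open>C\<close> intertwines \<open>e1 \<rightarrow> e0\<close>;
    hence \<open>dim gl(m|2n)\<^sup>e\<^sub>1\<close> is the sum of the dimensions of both intertwiner spaces.
  \<^item> \<open>z \<in> osp\<close> iff \<open>C = -G0\<^sup>-\<^sup>1 B\<^sup>T G1\<close>, and this \<open>C\<close> intertwines automatically when \<open>B\<close>
    does, so \<open>osp(m|2n)\<^sup>e\<^sub>1\<close> is isomorphic to the intertwiners \<open>e0 \<rightarrow> e1\<close>.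
  \<^item> For nilpotent matrices of Jordan types \<open>p\<close> and \<open>q\<close>, the intertwiners have dimension
    \<open>\<Sum>\<^sub>i \<Sum>\<^sub>j min p\<^sub>i q\<^sub>j\<close>: an explicit basis maps the head of one chain of \<open>e0\<close> onto a tail
    segment of one chain of \<open>e1\<close>.
\<close>

section \<open>Matrices form a finite-dimensional vector space\<close>

text \<open>The matrix units span the space of matrices and are independent; this makes the
  interpretation \<open>mat\<close> from the definitions a finite-dimensional vector space, so that
  \<open>mat.dim\<close> behaves as expected.\<close>

definition matrix_unit :: "'m::finite \<Rightarrow> 'n::finite \<Rightarrow> 'a::field^'n^'m" where
  "matrix_unit r c = (\<chi> i j. if i = r \<and> j = c then 1 else 0)"

definition matrix_units :: "('a::field^'n::finite^'m::finite) set" where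
  "matrix_units = (\<lambda>(r,c). matrix_unit r c) ` UNIV"

lemma mscale_component [simp]: "mscale c A $ i $ j = c * A $ i $ j"
  by (simp add: mscale_def)

lemma matrix_expansion:
  "(A :: 'a::field^'n::finite^'m::finite)
     = (\<Sum>y\<in>UNIV. mscale (A $ fst y $ snd y) (matrix_unit (fst y) (snd y)))"
proof -
  have "(\<Sum>y\<in>UNIV. mscale (A $ fst y $ snd y) (matrix_unit (fst y) (snd y)) :: 'a^'n^'m) $ i $ j
      = (\<Sum>y\<in>UNIV. if y = (i,j) then A $ i $ j else 0)" for i j
    unfolding sum_component by (rule sum.cong) (auto simp: matrix_unit_def)
  then show ?thesis by (simp add: vec_eq_iff)
qed

lemma matrix_units_independent:
  "\<not> mat.dependent (matrix_units :: ('a::field^'n::finite^'m::finite) set)"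
proof (rule mat.independent_if_scalars_zero)
  show "finite (matrix_units :: ('a^'n^'m) set)" unfolding matrix_units_def by simp
  fix f :: "'a^'n^'m \<Rightarrow> 'a" and x :: "'a^'n^'m"
  assume zero: "(\<Sum>x\<in>matrix_units. mscale (f x) x) = 0" and x: "x \<in> matrix_units"
  obtain r c where x_eq: "x = matrix_unit r c" using x unfolding matrix_units_def by auto
  have inj: "inj (\<lambda>(r,c). matrix_unit r c :: 'a^'n^'m)"
  proof (rule injI, clarify)
    fix r c r' c' assume "(matrix_unit r c :: 'a^'n^'m) = matrix_unit r' c'"
    then have "(matrix_unit r c :: 'a^'n^'m) $ r $ c = matrix_unit r' c' $ r $ c" by simp
    then show "r = r' \<and> c = c'" by (simp add: matrix_unit_def split: if_splits)
  qed
  have "0 = (\<Sum>x\<in>matrix_units. mscale (f x) x :: 'a^'n^'m) $ r $ c" using zero by simp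
  also have "\<dots> = (\<Sum>y\<in>UNIV. f (matrix_unit (fst y) (snd y))
                              * (matrix_unit (fst y) (snd y) :: 'a^'n^'m) $ r $ c)"
    unfolding matrix_units_def sum_component by (subst sum.reindex[OF inj]) (simp add: case_prod_beta)
  also have "\<dots> = (\<Sum>y\<in>UNIV. if y = (r,c) then f (matrix_unit r c) else 0)"
    by (rule sum.cong) (auto simp: matrix_unit_def)
  also have "\<dots> = f x" by (simp add: x_eq)
  finally show "f x = 0" by simp
qed

lemma matrix_units_span: "mat.span (matrix_units :: ('a::field^'n::finite^'m::finite) set) = UNIV"
proof -
  have "A \<in> mat.span (matrix_units :: ('a^'n^'m) set)" for A
    by (subst matrix_expansion, rule mat.span_sum, rule mat.span_scale, rule mat.span_base)
       (auto simp: matrix_units_def)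
  then show ?thesis by auto
qed

interpretation mat: finite_dimensional_vector_space
    "mscale :: 'a::field \<Rightarrow> 'a^'n::finite^'m::finite \<Rightarrow> 'a^'n^'m" matrix_units
  by unfold_locales (simp_all add: matrix_units_independent matrix_units_span,
      simp add: matrix_units_def)

interpretation mat: finite_dimensional_vector_space_pair
    "mscale :: 'a::field \<Rightarrow> 'a^'n::finite^'m::finite \<Rightarrow> 'a^'n^'m" matrix_units
    "mscale :: 'a::field \<Rightarrow> 'a^'n2::finite^'m2::finite \<Rightarrow> 'a^'n2^'m2" matrix_units ..

text \<open>Compatibility of the scalar action with products, used to see that the sets below
  are subspaces and the maps below are linear.\<close>
lemma mscale_mult_left: "(N :: 'a::field^_^_) ** mscale c A = mscale c (N ** A)"
  by (simp add: mscale_def matrix_matrix_mult_def vec_eq_iff sum_distrib_left mult_ac)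

lemma mscale_mult_right: "mscale c A ** (N :: 'a::field^_^_) = mscale c (A ** N)"
  by (simp add: mscale_def matrix_matrix_mult_def vec_eq_iff sum_distrib_left mult_ac)

lemma mscale_mult_vector: "mscale c A *v x = c *s (A *v x)"
  by (simp add: mscale_def matrix_vector_mult_def vector_scalar_mult_def vec_eq_iff
      sum_distrib_left mult.assoc)

lemma matrix_sum_mult_vector:
  "(\<Sum>x\<in>S. f x :: 'a::comm_semiring_1^'n::finite^'m::finite) *v y = (\<Sum>x\<in>S. f x *v y)"
  by (induction S rule: infinite_finite_induct) (auto simp: matrix_vector_mult_add_rdistrib)

lemma matrix_add_rdistrib: "(A + B) ** C = A ** C + B ** (C :: 'a::semiring_1^_^_)"
  by (vector matrix_matrix_mult_def sum.distrib[symmetric] field_simps)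

section \<open>Jordan chain bases\<close>

text \<open>A Jordan basis of type \<open>p\<close> for \<open>N\<close>: vectors \<open>v i k\<close> (\<open>i < length p\<close>, \<open>k < p!i\<close>)
  forming a basis, with \<open>N\<close> shifting each chain \<open>v i 0 \<mapsto> v i 1 \<mapsto> \<dots> \<mapsto> 0\<close>.
  This is the content of \<open>jordan_type\<close>, with the index set made explicit.\<close>

definition chain_index :: "nat list \<Rightarrow> (nat \<times> nat) set" where
  "chain_index p = (SIGMA i:{..<length p}. {..<p!i})"

definition jordan_basis :: "'k::field^'c::finite^'c \<Rightarrow> nat list \<Rightarrow> (nat \<Rightarrow> nat \<Rightarrow> 'k^'c) \<Rightarrow> bool" where
  "jordan_basis N p v \<longleftrightarrow>
     (\<forall>(i,k)\<in>chain_index p. N *v v i k = (if Suc k < p!i then v i (Suc k) else 0)) \<and>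
     inj_on (case_prod v) (chain_index p) \<and>
     \<not> vec.dependent (case_prod v ` chain_index p) \<and>
     vec.span (case_prod v ` chain_index p) = UNIV"

lemma chain_index_iff [simp]: "(i,k) \<in> chain_index p \<longleftrightarrow> i < length p \<and> k < p!i"
  by (simp add: chain_index_def)

lemma finite_chain_index [simp]: "finite (chain_index p)"
  by (simp add: chain_index_def)

text \<open>Every Jordan type comes with a Jordan basis.\<close>
lemma jordan_type_imp_basis:
  assumes "jordan_type N p"
  obtains v where "jordan_basis N p v"
proof -
  have index: "{(i,k). i < length p \<and> k < p!i} = chain_index p" by auto
  have "\<exists>v. jordan_basis N p v"
    using assms unfolding jordan_type_def jordan_basis_def Let_def index by (elim conjE) assumption
  then show ?thesis using that by blast
qed

context
  fixes N :: "'k::field^'c::finite^'c" and p v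
  assumes basis: "jordan_basis N p v"
begin

lemma jordan_basis_step:
  assumes "i < length p" "k < p!i"
  shows "N *v v i k = (if Suc k < p!i then v i (Suc k) else 0)"
proof -
  have "\<forall>(i,k)\<in>chain_index p. N *v v i k = (if Suc k < p!i then v i (Suc k) else 0)"
    using basis unfolding jordan_basis_def by blast
  from bspec[OF this, of "(i,k)"] show ?thesis using assms by simp
qed

text \<open>Applying \<open>N^k\<close> moves \<open>k\<close> steps down a chain, or kills the vector.\<close>
lemma jordan_basis_power:
  assumes "i < length p" "l < p!i"
  shows "((*v) N ^^ k) (v i l) = (if l + k < p!i then v i (l + k) else 0)"
proof (induction k)
  case (Suc k)
  show ?case
  proof (cases "l + k < p!i")
    case True
    then show ?thesis using Suc jordan_basis_step[OF assms(1) True] by simp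
  qed (use Suc in simp)
qed (use assms in simp)

text \<open>Basic facts unpacked from the definition: the chain vectors are independent,
  pairwise distinct and nonzero.\<close>
lemma jordan_basis_independent: "\<not> vec.dependent (case_prod v ` chain_index p)"
  using basis unfolding jordan_basis_def by auto

lemma jordan_basis_inj: "inj_on (case_prod v) (chain_index p)"
  using basis unfolding jordan_basis_def by auto

lemma jordan_basis_nonzero:
  assumes "i < length p" "k < p!i"
  shows "v i k \<noteq> 0"
proof
  assume "v i k = 0"
  moreover have "v i k \<in> case_prod v ` chain_index p"
    by (rule image_eqI[of _ _ "(i,k)"]) (use assms in auto)
  ultimately have "vec.dependent (case_prod v ` chain_index p)" using vec.dependent_zero by simp
  then show False using jordan_basis_independent by simp
qed

lemma jordan_basis_eq_iff:
  "(i,k) \<in> chain_index p \<Longrightarrow> (i',k') \<in> chain_index p \<Longrightarrow> v i k = v i' k' \<longleftrightarrow> i = i' \<and> k = k'"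
  using inj_on_eq_iff[OF jordan_basis_inj, of "(i,k)" "(i',k')"] by simp

text \<open>Every vector is a combination of the basis vectors, indexed by chain positions.\<close>
lemma jordan_basis_expansion: "\<exists>c. y = (\<Sum>x\<in>chain_index p. c x *s case_prod v x)"
proof -
  have "y \<in> vec.span (case_prod v ` chain_index p)" using basis unfolding jordan_basis_def by simp
  then obtain c where "y = (\<Sum>b\<in>case_prod v ` chain_index p. c b *s b)"
    unfolding vec.span_finite[OF finite_imageI[OF finite_chain_index]] by auto
  also have "\<dots> = (\<Sum>x\<in>chain_index p. c (case_prod v x) *s case_prod v x)"
    by (rule sum.reindex[OF jordan_basis_inj, unfolded comp_def])
  finally show ?thesis by (rule exI[of _ "\<lambda>x. c (case_prod v x)"])
qed

text \<open>A matrix may prescribe arbitrary images of the basis vectors.\<close>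
lemma jordan_basis_extend:
  "\<exists>M :: 'k^'c^'d::finite. \<forall>i k. i < length p \<longrightarrow> k < p!i \<longrightarrow> M *v v i k = f i k"
proof -
  define V where "V = case_prod v ` chain_index p"
  define g where "g y = case_prod f (the_inv_into (chain_index p) (case_prod v) y)" for y
  have indep: "vec.independent V" using jordan_basis_independent V_def by simp
  have lin: "Vector_Spaces.linear (*s) (*s) (vec.construct V g)" by (rule vec.linear_construct[OF indep])
  have images: "matrix (vec.construct V g) *v v i k = f i k" if "(i,k) \<in> chain_index p" for i k
  proof -
    have "v i k \<in> V" unfolding V_def by (rule image_eqI[of _ _ "(i,k)"]) (use that in auto)
    moreover have "the_inv_into (chain_index p) (case_prod v) (v i k) = (i,k)"
      using the_inv_into_f_f[OF jordan_basis_inj that] by simp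
    ultimately have "vec.construct V g (v i k) = f i k"
      by (simp add: vec.construct_basis[OF indep] g_def)
    then show ?thesis by (simp add: matrix_works[OF lin])
  qed
  show ?thesis by (intro exI[of _ "matrix (vec.construct V g)"] allI impI images) simp
qed

text \<open>Two matrices agreeing on the basis are equal.\<close>
lemma jordan_basis_matrix_eq:
  fixes A A' :: "'k^'c^'d::finite"
  assumes "\<And>i k. i < length p \<Longrightarrow> k < p!i \<Longrightarrow> A *v v i k = A' *v v i k"
  shows "A = A'"
proof -
  have "A *v x = A' *v x" for x
  proof (rule vec.linear_eq_on[OF matrix_vector_mul_linear_gen matrix_vector_mul_linear_gen])
    show "x \<in> vec.span (case_prod v ` chain_index p)" using basis unfolding jordan_basis_def by simp
  qed (use assms in auto)
  then show ?thesis by (simp add: matrix_eq)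
qed

end

text \<open>Coefficients of an independent family are zero in a vanishing combination.\<close>
lemma independent_combination_zero:
  fixes h :: "'x \<Rightarrow> 'k::field^'n::finite"
  assumes "\<not> vec.dependent W" "finite F" "inj_on h F" "h ` F \<subseteq> W"
    and "(\<Sum>x\<in>F. a x *s h x) = 0" and "x \<in> F"
  shows "a x = 0"
proof -
  have indep: "\<not> vec.dependent (h ` F)" using assms(1,4) vec.dependent_mono by blast
  define c where "c y = a (the_inv_into F h y)" for y
  have "(\<Sum>y\<in>h ` F. c y *s y) = (\<Sum>x\<in>F. a x *s h x)"
    by (subst sum.reindex[OF assms(3)]) (simp add: c_def the_inv_into_f_f[OF assms(3)])
  then have "(\<Sum>y\<in>h ` F. c y *s y) = 0" using assms(5) by simp
  then have "c (h x) = 0" using indep vec.independent_explicit assms(6) by blast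
  then show ?thesis by (simp add: c_def the_inv_into_f_f[OF assms(3) assms(6)])
qed

section \<open>Intertwiners between two nilpotent matrices\<close>

text \<open>The matrices \<open>B\<close> with \<open>N2 B = B N1\<close>, i.e. the linear maps intertwining \<open>N1\<close> and \<open>N2\<close>.\<close>
definition intertwiners :: "'k::field^'a::finite^'a \<Rightarrow> 'k^'b::finite^'b \<Rightarrow> ('k^'a^'b) set" where
  "intertwiners N1 N2 = {B. N2 ** B = B ** N1}"

lemma intertwiners_subspace: "mat.subspace (intertwiners N1 N2)"
  unfolding mat.subspace_def intertwiners_def
  by (auto simp: matrix_add_ldistrib matrix_add_rdistrib mscale_mult_left mscale_mult_right)

text \<open>Iterating \<open>x \<mapsto> N x\<close> is multiplication by a matrix power, hence linear.\<close>
lemma iterate_matrix_vector: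
  "((*v) (N :: 'k::comm_semiring_1^'n::finite^'n) ^^ k) = (*v) (((**) N ^^ k) (mat 1))"
  by (induction k) (simp_all add: fun_eq_iff matrix_vector_mul_assoc)

text \<open>An intertwiner commutes with powers: \<open>N2\<^sup>k B = B N1\<^sup>k\<close>.\<close>
lemma intertwiner_power:
  assumes "B \<in> intertwiners N1 N2"
  shows "((*v) N2 ^^ k) (B *v x) = B *v ((*v) N1 ^^ k) x"
proof (induction k)
  case (Suc k)
  have "N2 *v (B *v y) = B *v (N1 *v y)" for y
    using assms by (simp add: intertwiners_def matrix_vector_mul_assoc)
  then show ?case using Suc by simp
qed simp

text \<open>An intertwiner is determined by its values on the heads \<open>v i 0\<close> of the Jordan chains,
  since the rest of each chain is obtained by applying powers of \<open>N1\<close>.\<close>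
lemma intertwiner_eq_on_heads:
  assumes basis: "jordan_basis N1 p v" and pos: "\<forall>x\<in>set p. 0 < x"
    and B: "B \<in> intertwiners N1 N2" and B': "B' \<in> intertwiners N1 N2"
    and heads: "\<And>i. i < length p \<Longrightarrow> B *v v i 0 = B' *v v i 0"
  shows "B = B'"
proof (rule jordan_basis_matrix_eq[OF basis])
  fix i k assume ik: "i < length p" "k < p!i"
  have "v i k = ((*v) N1 ^^ k) (v i 0)"
    using jordan_basis_power[OF basis ik(1), of 0 k] pos ik by simp
  then show "B *v v i k = B' *v v i k"
    by (simp add: intertwiner_power[OF B, symmetric] intertwiner_power[OF B', symmetric] heads ik)
qed

text \<open>If \<open>N^d\<close> kills a vector, its coordinates in a Jordan basis vanish at all positions
  more than \<open>d\<close> steps away from the end of their chain.\<close>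
lemma jordan_basis_kernel_coefficients:
  assumes basis: "jordan_basis N q w"
    and kernel: "((*v) N ^^ d) (\<Sum>x\<in>chain_index q. c x *s case_prod w x) = 0"
    and jl: "j < length q" "l + d < q!j"
  shows "c (j,l) = 0"
proof -
  define F where "F = {x \<in> chain_index q. snd x + d < q!fst x}"
  define h where "h x = w (fst x) (snd x + d)" for x
  have "0 = (\<Sum>x\<in>chain_index q. c x *s ((*v) N ^^ d) (case_prod w x))"
    using kernel by (simp add: iterate_matrix_vector vec.sum vector_scalar_commute)
  also have "\<dots> = (\<Sum>x\<in>chain_index q. if snd x + d < q!fst x then c x *s h x else 0)"
    by (rule sum.cong) (auto simp: h_def jordan_basis_power[OF basis] add.commute)
  also have "\<dots> = (\<Sum>x\<in>F. c x *s h x)"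
    unfolding F_def by (simp add: sum.inter_filter)
  finally have sum_zero: "(\<Sum>x\<in>F. c x *s h x) = 0" by simp
  have inj: "inj_on h F"
    by (rule inj_onI) (auto simp: F_def h_def jordan_basis_eq_iff[OF basis])
  have image: "h ` F \<subseteq> case_prod w ` chain_index q"
    by (auto simp: F_def h_def intro!: image_eqI[of _ _ "(fst x, snd x + d)" for x])
  show ?thesis
    by (rule independent_combination_zero[OF jordan_basis_independent[OF basis] _ inj image sum_zero])
       (use jl in \<open>auto simp: F_def\<close>)
qed

section \<open>The dimension of the space of intertwiners\<close>

text \<open>Fix Jordan bases \<open>v\<close> of \<open>N1\<close> (type \<open>p\<close>) and \<open>w\<close> of \<open>N2\<close> (type \<open>q\<close>).  For each chain
  \<open>i\<close> of \<open>N1\<close>, chain \<open>j\<close> of \<open>N2\<close> and \<open>t < min (p!i) (q!j)\<close> there is an elementary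
  intertwiner sending \<open>v i k\<close> to \<open>w j (offset i j + t + k)\<close> (zero past the end of chain \<open>j\<close>)
  and killing all other chains.  These \<open>\<Sum>\<^sub>i \<Sum>\<^sub>j min (p!i) (q!j)\<close> matrices form a basis
  of the intertwiners.\<close>

locale jordan_pair =
  fixes N1 :: "'k::field^'a::finite^'a" and p :: "nat list" and v :: "nat \<Rightarrow> nat \<Rightarrow> 'k^'a"
    and N2 :: "'k^'b::finite^'b" and q :: "nat list" and w :: "nat \<Rightarrow> nat \<Rightarrow> 'k^'b"
  assumes basis1: "jordan_basis N1 p v" and basis2: "jordan_basis N2 q w"
    and p_pos: "\<forall>x\<in>set p. 0 < x"
begin

text \<open>Indices \<open>(j,t)\<close> of the elementary intertwiners starting at chain \<open>i\<close>, and all of them.\<close>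
definition slice :: "nat \<Rightarrow> (nat \<times> nat) set" where
  "slice i = (SIGMA j:{..<length q}. {..<min (p!i) (q!j)})"

definition triples :: "(nat \<times> nat \<times> nat) set" where
  "triples = (SIGMA i:{..<length p}. slice i)"

text \<open>The head of chain \<open>i\<close> is sent to position \<open>offset i j + t\<close> of chain \<open>j\<close>.\<close>
definition offset :: "nat \<Rightarrow> nat \<Rightarrow> nat" where
  "offset i j = q!j - p!i"

definition head_index :: "nat \<Rightarrow> nat \<times> nat \<Rightarrow> nat \<times> nat" where
  "head_index i = (\<lambda>(j,t). (j, offset i j + t))"

definition elementary :: "nat \<times> nat \<times> nat \<Rightarrow> 'k^'a^'b" where
  "elementary = (\<lambda>(i,j,t). SOME M. \<forall>i' k. i' < length p \<longrightarrow> k < p!i' \<longrightarrow>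
     M *v v i' k = (if i' = i \<and> offset i j + t + k < q!j then w j (offset i j + t + k) else 0))"

lemma finite_triples: "finite triples"
  by (simp add: triples_def slice_def)

lemma slice_iff: "(j,t) \<in> slice i \<longleftrightarrow> j < length q \<and> t < p!i \<and> offset i j + t < q!j"
  by (auto simp: slice_def offset_def)

text \<open>The defining property of the elementary intertwiners.\<close>
lemma elementary_apply:
  assumes "i' < length p" "k < p!i'"
  shows "elementary (i,j,t) *v v i' k
           = (if i' = i \<and> offset i j + t + k < q!j then w j (offset i j + t + k) else 0)"
proof -
  let ?F = "\<lambda>i' k. if i' = i \<and> offset i j + t + k < q!j then w j (offset i j + t + k) else 0"
  have "\<exists>M :: 'k^'a^'b. \<forall>i' k. i' < length p \<longrightarrow> k < p!i' \<longrightarrow> M *v v i' k = ?F i' k"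
    by (rule jordan_basis_extend[OF basis1])
  from someI_ex[OF this] show ?thesis using assms unfolding elementary_def prod.case by blast
qed

text \<open>Both \<open>N2 E\<close> and \<open>E N1\<close> shift by one step along the chains, so \<open>E\<close> intertwines.\<close>
lemma elementary_intertwines:
  assumes "(j,t) \<in> slice i"
  shows "elementary (i,j,t) \<in> intertwiners N1 N2"
  unfolding intertwiners_def mem_Collect_eq
proof (rule jordan_basis_matrix_eq[OF basis1])
  fix i' k assume ik: "i' < length p" "k < p!i'"
  have j: "j < length q" using assms by (simp add: slice_iff)
  define l where "l = offset i j + t + k"
  have lhs: "(N2 ** elementary (i,j,t)) *v v i' k
      = (if i' = i \<and> l < q!j then (if Suc l < q!j then w j (Suc l) else 0) else 0)"
    by (simp add: matrix_vector_mul_assoc[symmetric] elementary_apply[OF ik] jordan_basis_step[OF basis2 j] l_def)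
  have rhs: "(elementary (i,j,t) ** N1) *v v i' k
      = (if Suc k < p!i' then (if i' = i \<and> Suc l < q!j then w j (Suc l) else 0) else 0)"
    by (simp add: matrix_vector_mul_assoc[symmetric] jordan_basis_step[OF basis1 ik] elementary_apply[OF ik(1)] l_def)
  have "Suc l < q!j \<Longrightarrow> i' = i \<Longrightarrow> Suc k < p!i'"
    using ik unfolding l_def offset_def by auto
  then show "(N2 ** elementary (i,j,t)) *v v i' k = (elementary (i,j,t) ** N1) *v v i' k"
    unfolding lhs rhs by auto
qed

text \<open>Positions of the images of the heads in the chains of \<open>N2\<close>: exactly the last
  \<open>p!i\<close> positions of each chain.\<close>
lemma head_index_inj: "inj_on (head_index i) (slice i)"
  by (rule inj_onI) (auto simp: head_index_def)

lemma head_index_image: "head_index i ` slice i = {x \<in> chain_index q. offset i (fst x) \<le> snd x}"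
proof (intro equalityI subsetI)
  fix x assume "x \<in> head_index i ` slice i"
  then show "x \<in> {x \<in> chain_index q. offset i (fst x) \<le> snd x}"
    by (auto simp: head_index_def slice_iff)
next
  fix x assume "x \<in> {x \<in> chain_index q. offset i (fst x) \<le> snd x}"
  then obtain j l where x: "x = (j,l)" and jl: "j < length q" "l < q!j" "offset i j \<le> l"
    by (cases x) auto
  then show "x \<in> head_index i ` slice i"
    by (intro image_eqI[of _ _ "(j, l - offset i j)"]) (auto simp: head_index_def slice_iff offset_def)
qed

lemma head_index_mem: "x \<in> slice i \<Longrightarrow> head_index i x \<in> chain_index q"
  using head_index_image by blast

text \<open>The head of chain \<open>i\<close> is sent to a basis vector by the elementary intertwiners
  belonging to chain \<open>i\<close>, and to zero by all others.\<close>
lemma elementary_head: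
  assumes "i < length p" "x \<in> slice i'"
  shows "elementary (i',x) *v v i 0 = (if i' = i then case_prod w (head_index i x) else 0)"
proof -
  obtain j t where "x = (j,t)" by fastforce
  then show ?thesis using elementary_apply[of i 0 i' j t] assms p_pos
    by (auto simp: slice_iff head_index_def)
qed

text \<open>Evaluating a combination of elementary intertwiners at the head of chain \<open>i\<close>.\<close>
lemma head_combination:
  assumes i: "i < length p"
  shows "(\<Sum>\<tau>\<in>triples. a \<tau> *s (elementary \<tau> *v v i 0))
           = (\<Sum>x\<in>slice i. a (i, x) *s case_prod w (head_index i x))"
proof -
  have "(\<Sum>\<tau>\<in>triples. a \<tau> *s (elementary \<tau> *v v i 0))
      = (\<Sum>i'<length p. \<Sum>x\<in>slice i'. a (i',x) *s (elementary (i',x) *v v i 0))"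
    unfolding triples_def by (subst sum.Sigma) (auto simp: slice_def)
  also have "\<dots> = (\<Sum>i'<length p. if i' = i then \<Sum>x\<in>slice i. a (i,x) *s case_prod w (head_index i x) else 0)"
    by (intro sum.cong refl) (auto simp: elementary_head[OF i])
  also have "\<dots> = (\<Sum>x\<in>slice i. a (i,x) *s case_prod w (head_index i x))"
    using i by simp
  finally show ?thesis .
qed

text \<open>Distinct indices give distinct elementary intertwiners (compare images of heads).\<close>
lemma elementary_inj: "inj_on elementary triples"
proof (rule inj_onI)
  fix \<tau> \<tau>' assume in1: "\<tau> \<in> triples" and in2: "\<tau>' \<in> triples"
    and eq: "elementary \<tau> = elementary \<tau>'"
  obtain i x i' x' where \<tau>: "\<tau> = (i,x)" "\<tau>' = (i',x')" by (cases \<tau>, cases \<tau>') blast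
  have i: "i < length p" and s1: "x \<in> slice i" and s2: "x' \<in> slice i'"
    using in1 in2 \<tau> by (auto simp: triples_def)
  have "case_prod w (head_index i x) = (if i' = i then case_prod w (head_index i x') else 0)"
    using arg_cong[OF eq, of "\<lambda>M. M *v v i 0"] elementary_head[OF i s1] elementary_head[OF i s2]
    by (simp add: \<tau>)
  moreover have "case_prod w (head_index i x) \<noteq> 0"
    using head_index_mem[OF s1] jordan_basis_nonzero[OF basis2] by (cases "head_index i x") auto
  ultimately have ii: "i' = i" and "case_prod w (head_index i x) = case_prod w (head_index i x')"
    by (auto split: if_splits)
  then have "head_index i x = head_index i x'"
    using inj_onD[OF jordan_basis_inj[OF basis2]] head_index_mem s1 s2 by blast
  then have "x = x'" using inj_onD[OF head_index_inj] s1 s2 ii by blast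
  then show "\<tau> = \<tau>'" using \<tau> ii by simp
qed

text \<open>Independence: evaluating a vanishing combination at the head of chain \<open>i\<close> gives a
  vanishing combination of distinct basis vectors of \<open>N2\<close>.\<close>
lemma elementary_independent: "\<not> mat.dependent (elementary ` triples)"
proof (rule mat.independent_if_scalars_zero)
  show "finite (elementary ` triples)" using finite_triples by simp
  fix f and M assume zero: "(\<Sum>M\<in>elementary ` triples. mscale (f M) M) = 0"
    and M: "M \<in> elementary ` triples"
  obtain i x where ix: "(i,x) \<in> triples" "M = elementary (i,x)" using M by auto
  have i: "i < length p" and x: "x \<in> slice i" using ix by (auto simp: triples_def)
  have "(\<Sum>\<tau>\<in>triples. mscale (f (elementary \<tau>)) (elementary \<tau>)) *v v i 0 = 0"
    using zero by (simp add: sum.reindex[OF elementary_inj])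
  then have "(\<Sum>y\<in>slice i. f (elementary (i,y)) *s case_prod w (head_index i y)) = 0"
    by (simp add: matrix_sum_mult_vector mscale_mult_vector head_combination[OF i])
  moreover have "inj_on (\<lambda>y. case_prod w (head_index i y)) (slice i)"
    using head_index_mem
    by (intro comp_inj_on[OF head_index_inj inj_on_subset[OF jordan_basis_inj[OF basis2]], unfolded comp_def])
       auto
  moreover have "(\<lambda>y. case_prod w (head_index i y)) ` slice i \<subseteq> case_prod w ` chain_index q"
    using head_index_mem by blast
  ultimately have "f (elementary (i,x)) = 0"
    by (intro independent_combination_zero[OF jordan_basis_independent[OF basis2], of "slice i"] x)
       (auto simp: slice_def)
  then show "f M = 0" using ix by simp
qed

end

context jordan_pair begin

text \<open>Every intertwiner \<open>B\<close> is a combination of elementary ones: \<open>B\<close> sends the head of chain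
  \<open>i\<close> into the kernel of \<open>N2^(p!i)\<close>, which is spanned by the last \<open>p!i\<close> vectors of each chain
  of \<open>N2\<close>; the matching combination agrees with \<open>B\<close> on all heads.\<close>
lemma elementary_span: "intertwiners N1 N2 \<subseteq> mat.span (elementary ` triples)"
proof
  fix B assume B: "B \<in> intertwiners N1 N2"
  have "\<forall>i. \<exists>c. B *v v i 0 = (\<Sum>x\<in>chain_index q. c x *s case_prod w x)"
    using jordan_basis_expansion[OF basis2] by blast
  then obtain c where c: "\<And>i. B *v v i 0 = (\<Sum>x\<in>chain_index q. c i x *s case_prod w x)"
    by (metis choice)
  have vanish: "c i (j,l) = 0" if i: "i < length p" and "j < length q" "l < offset i j" for i j l
  proof (rule jordan_basis_kernel_coefficients[OF basis2, of "p!i"])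
    have "((*v) N2 ^^ (p!i)) (B *v v i 0) = 0"
      using intertwiner_power[OF B] jordan_basis_power[OF basis1 i, of 0 "p!i"] p_pos i by simp
    then show "((*v) N2 ^^ (p!i)) (\<Sum>x\<in>chain_index q. c i x *s case_prod w x) = 0"
      by (simp add: c)
  qed (use that in \<open>auto simp: offset_def\<close>)
  define S where "S = (\<Sum>(i,x)\<in>triples. mscale (c i (head_index i x)) (elementary (i,x)))"
  have "S \<in> mat.span (elementary ` triples)"
    unfolding S_def by (rule mat.span_sum) (auto intro: mat.span_scale mat.span_base)
  moreover have "S \<in> intertwiners N1 N2"
    unfolding S_def
    by (rule mat.subspace_sum[OF intertwiners_subspace])
       (auto intro: mat.subspace_scale[OF intertwiners_subspace] elementary_intertwines
         simp: triples_def)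
  moreover have "S *v v i 0 = B *v v i 0" if i: "i < length p" for i
  proof -
    have "S *v v i 0 = (\<Sum>x\<in>slice i. c i (head_index i x) *s case_prod w (head_index i x))"
      using head_combination[OF i, of "\<lambda>(i,x). c i (head_index i x)"]
      by (simp add: S_def matrix_sum_mult_vector mscale_mult_vector case_prod_beta')
    also have "\<dots> = (\<Sum>y\<in>head_index i ` slice i. c i y *s case_prod w y)"
      by (rule sum.reindex[OF head_index_inj, symmetric, unfolded comp_def])
    also have "\<dots> = (\<Sum>y\<in>chain_index q. c i y *s case_prod w y)"
      using vanish[OF i] by (intro sum.mono_neutral_left) (auto simp: head_index_image, metis not_le)
    also have "\<dots> = B *v v i 0" by (simp add: c)
    finally show ?thesis .
  qed
  ultimately show "B \<in> mat.span (elementary ` triples)"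
    using intertwiner_eq_on_heads[OF basis1 p_pos B] by metis
qed

text \<open>Dimension count: the elementary intertwiners form a basis, indexed by \<open>triples\<close>.\<close>
theorem dim_intertwiners:
  "mat.dim (intertwiners N1 N2) = (\<Sum>i<length p. \<Sum>j<length q. min (p!i) (q!j))"
proof -
  have "mat.dim (intertwiners N1 N2) = card (elementary ` triples)"
    using elementary_intertwines elementary_span elementary_independent
    by (intro mat.basis_card_eq_dim[symmetric]) (auto simp: triples_def)
  also have "\<dots> = card triples" by (rule card_image[OF elementary_inj])
  also have "\<dots> = (\<Sum>i<length p. \<Sum>j<length q. min (p!i) (q!j))"
    by (simp add: triples_def slice_def)
  finally show ?thesis .
qed

end

section \<open>Block matrices for \<open>V = V\<^sub>0 \<oplus> V\<^sub>1\<close>\<close>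

text \<open>\<open>block A B C D\<close> is the matrix \<open>[A B; C D]\<close> with respect to \<open>V\<^sub>0 \<oplus> V\<^sub>1\<close>; \<open>block00\<close>,
  \<dots>, \<open>block11\<close> extract the four blocks.\<close>
definition block :: "'x^'a::finite^'a \<Rightarrow> 'x^'b::finite^'a \<Rightarrow> 'x^'a^'b \<Rightarrow> 'x^'b^'b \<Rightarrow> 'x^('a+'b)^('a+'b)" where
  "block A B C D = (\<chi> r c. case r of
      Inl i \<Rightarrow> (case c of Inl j \<Rightarrow> A$i$j | Inr j \<Rightarrow> B$i$j)
    | Inr i \<Rightarrow> (case c of Inl j \<Rightarrow> C$i$j | Inr j \<Rightarrow> D$i$j))"

definition block00 :: "'x^('a::finite+'b::finite)^('a+'b) \<Rightarrow> 'x^'a^'a" where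
  "block00 z = (\<chi> i j. z$(Inl i)$(Inl j))"
definition block01 :: "'x^('a::finite+'b::finite)^('a+'b) \<Rightarrow> 'x^'b^'a" where
  "block01 z = (\<chi> i j. z$(Inl i)$(Inr j))"
definition block10 :: "'x^('a::finite+'b::finite)^('a+'b) \<Rightarrow> 'x^'a^'b" where
  "block10 z = (\<chi> i j. z$(Inr i)$(Inl j))"
definition block11 :: "'x^('a::finite+'b::finite)^('a+'b) \<Rightarrow> 'x^'b^'b" where
  "block11 z = (\<chi> i j. z$(Inr i)$(Inr j))"

text \<open>The diagonal blocks agree with those of the definitions.\<close>
lemma blk0_eq_block00: "blk0 = block00"
  by (simp add: fun_eq_iff blk0_def block00_def)

lemma blk1_eq_block11: "blk1 = block11"
  by (simp add: fun_eq_iff blk1_def block11_def)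

text \<open>Algebra of block matrices: components, decomposition, and compatibility with the
  matrix operations.\<close>
lemma block_component [simp]:
  "block A B C D $ Inl i $ Inl j = A$i$j" "block A B C D $ Inl i $ Inr j' = B$i$j'"
  "block A B C D $ Inr i' $ Inl j = C$i'$j" "block A B C D $ Inr i' $ Inr j' = D$i'$j'"
  by (simp_all add: block_def)

lemma block_parts [simp]:
  "block00 (block A B C D) = A" "block01 (block A B C D) = B"
  "block10 (block A B C D) = C" "block11 (block A B C D) = D"
  by (simp_all add: block00_def block01_def block10_def block11_def vec_eq_iff)

lemma block_decompose: "z = block (block00 z) (block01 z) (block10 z) (block11 z)"
  by (simp add: vec_eq_iff block_def block00_def block01_def block10_def block11_def split: sum.splits)

lemma block_eq_iff: "block A B C D = block A' B' C' D' \<longleftrightarrow> A = A' \<and> B = B' \<and> C = C' \<and> D = D'"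
  by (metis block_parts)

lemma sum_UNIV_sum_type:
  "(\<Sum>x\<in>(UNIV :: ('a::finite+'b::finite) set). f x) = (\<Sum>i\<in>UNIV. f (Inl i)) + (\<Sum>j\<in>UNIV. f (Inr j))"
  using sum.Plus[of "UNIV::'a set" "UNIV::'b set" f] by (simp add: o_def)

lemma block_mult: "block A B C D ** block A' B' C' D' =
   block (A**A' + B**C') (A**B' + B**D') (C**A' + D**C') (C**B' + D**D')"
  by (simp add: vec_eq_iff split_sum_all matrix_matrix_mult_def sum_UNIV_sum_type)

lemma block_transpose:
  "transpose (block A B C D) = block (transpose A) (transpose C) (transpose B) (transpose D)"
  by (simp add: vec_eq_iff transpose_def block_def split: sum.splits)

lemma block_add: "block A B C D + block A' B' C' D' = block (A+A') (B+B') (C+C') (D+D')"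
  by (simp add: vec_eq_iff block_def split: sum.splits)

lemma block_minus: "block A B C D - block A' B' C' D' = block (A-A') (B-B') (C-C') (D-D')"
  by (simp add: vec_eq_iff block_def split: sum.splits)

lemma block_uminus: "- block A B C D = block (-A) (-B) (-C) (-D)"
  by (simp add: vec_eq_iff block_def split: sum.splits)

lemma block_mscale: "mscale c (block A B C D) = block (mscale c A) (mscale c B) (mscale c C) (mscale c D)"
  by (simp add: vec_eq_iff block_def split: sum.splits)

lemma block_zero: "(0 :: 'x::zero^('a::finite+'b::finite)^('a+'b)) = block 0 0 0 0"
  by (simp add: vec_eq_iff block_def split: sum.splits)

lemma block_mat_1: "(mat 1 :: 'x::zero_neq_one^('a::finite+'b::finite)^('a+'b)) = block (mat 1) 0 0 (mat 1)"
  by (simp add: vec_eq_iff block_def mat_def split: sum.splits)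

text \<open>Even elements of \<open>gl(m|2n)\<close> are block diagonal, odd ones block off-diagonal.\<close>
lemma gl_part_even_iff: "z \<in> gl_part 0 \<longleftrightarrow> z = block (block00 z) 0 0 (block11 z)"
  unfolding gl_part_def vec_eq_iff
  by (auto simp: split_sum_all block_def block00_def block11_def)

lemma gl_part_odd_iff: "z \<in> gl_part 1 \<longleftrightarrow> z = block 0 (block01 z) (block10 z) 0"
  unfolding gl_part_def vec_eq_iff
  by (auto simp: split_sum_all block_def block01_def block10_def)

text \<open>Elementary identities for transposes and negation.\<close>
lemma transpose_add: "transpose (A + B) = transpose A + transpose B"
  by (simp add: vec_eq_iff transpose_def)

lemma transpose_uminus: "transpose (- A) = - transpose A"
  by (simp add: vec_eq_iff transpose_def)

lemma transpose_mscale: "transpose (mscale c A) = mscale c (transpose A)"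
  by (simp add: vec_eq_iff transpose_def)

lemma transpose_zero [simp]: "transpose 0 = 0"
  by (simp add: vec_eq_iff transpose_def)

lemma mult_uminus_left: "(- A) ** B = - (A ** (B :: 'x::comm_ring_1^_^_))"
  by (simp add: vec_eq_iff matrix_matrix_mult_def sum_negf)

lemma mult_uminus_right: "A ** (- B) = - (A ** (B :: 'x::comm_ring_1^_^_))"
  by (simp add: vec_eq_iff matrix_matrix_mult_def sum_negf)

section \<open>The orthosymplectic condition\<close>

text \<open>Moving a matrix across the bilinear form.\<close>
lemma bform_left: "bform G (z *v x) y = bform (transpose z ** G) x y"
proof -
  have "bform G (z *v x) y = (\<Sum>r\<in>UNIV. \<Sum>c\<in>UNIV. \<Sum>k\<in>UNIV. z$r$k * x$k * G$r$c * y$c)"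
    by (simp add: bform_def matrix_vector_mult_def sum_distrib_right)
  also have "\<dots> = (\<Sum>k\<in>UNIV. \<Sum>c\<in>UNIV. \<Sum>r\<in>UNIV. z$r$k * x$k * G$r$c * y$c)"
    by (subst sum.swap, subst (2) sum.swap, rule sum.cong[OF refl], subst sum.swap, rule refl)
  also have "\<dots> = bform (transpose z ** G) x y"
    unfolding bform_def matrix_matrix_mult_def transpose_def
    by (simp only: vec_lambda_beta sum_distrib_left sum_distrib_right) (intro sum.cong refl, simp only: mult_ac)
  finally show ?thesis .
qed

lemma bform_right: "bform G x (z *v y) = bform (G ** z) x y"
proof -
  have "bform G x (z *v y) = (\<Sum>r\<in>UNIV. \<Sum>c\<in>UNIV. \<Sum>k\<in>UNIV. x$r * G$r$c * z$c$k * y$k)"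
    by (simp add: bform_def matrix_vector_mult_def sum_distrib_left mult_ac)
  also have "\<dots> = (\<Sum>r\<in>UNIV. \<Sum>k\<in>UNIV. \<Sum>c\<in>UNIV. x$r * G$r$c * z$c$k * y$k)"
    by (rule sum.cong[OF refl], rule sum.swap)
  also have "\<dots> = bform (G ** z) x y"
    unfolding bform_def matrix_matrix_mult_def
    by (simp only: vec_lambda_beta sum_distrib_left sum_distrib_right) (intro sum.cong refl, simp only: mult_ac)
  finally show ?thesis .
qed

text \<open>The form on standard basis vectors reads off the Gram matrix.\<close>
lemma bform_axis:
  fixes A :: "complex^('a::finite+'b::finite)^('a+'b)"
  shows "bform A (axis r 1) (axis c 1) = A$r$c"
  by (simp add: bform_def axis_def if_distrib if_distribR sum.If_cases)

text \<open>Matrix form of the defining condition of \<open>osp(m|2n)\<^sub>i\<close>: testing the form on basis vectors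
  shows \<open>z\<^sup>T G = -(-1)\<^bsup>i\<cdot>deg r\<^esup> G z\<close> row by row, and conversely.\<close>
lemma osp_part_iff:
  fixes G z :: "complex^('a::finite+'b::finite)^('a+'b)"
  shows "z \<in> osp_part G i \<longleftrightarrow> z \<in> gl_part i \<and>
     (\<forall>r c. (transpose z ** G)$r$c = - ((-1) ^ (i * par r)) * (G ** z)$r$c)"
proof (intro iffI conjI allI)
  assume "z \<in> osp_part G i"
  then have cond: "\<And>d x y. d \<in> {0,1} \<Longrightarrow> homog_vec d x \<Longrightarrow>
      bform G (z *v x) y = - ((-1) ^ (i * d)) * bform G x (z *v y)"
    unfolding osp_part_def by auto
  fix r c :: "'a + 'b"
  have "par r \<in> {0,1}" by (cases r) auto
  moreover have "homog_vec (par r) (axis r 1)" by (simp add: homog_vec_def axis_def)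
  ultimately show "(transpose z ** G)$r$c = - ((-1) ^ (i * par r)) * (G ** z)$r$c"
    using cond[of "par r" "axis r 1" "axis c 1"] by (simp add: bform_left bform_right bform_axis)
next
  assume "z \<in> osp_part G i" then show "z \<in> gl_part i" by (simp add: osp_part_def)
next
  assume z: "z \<in> gl_part i \<and> (\<forall>r c. (transpose z ** G)$r$c = - ((-1) ^ (i * par r)) * (G ** z)$r$c)"
  have "bform G (z *v x) y = - ((-1) ^ (i * d)) * bform G x (z *v y)" if hom: "homog_vec d x" for d x y
  proof -
    have "x$r * (transpose z ** G)$r$c * y$c = - ((-1) ^ (i * d)) * (x$r * (G ** z)$r$c * y$c)" for r c
      using z hom by (cases "par r = d") (auto simp: homog_vec_def)
    then have "bform (transpose z ** G) x y = - ((-1) ^ (i * d)) * bform (G ** z) x y"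
      unfolding bform_def by (simp add: sum_distrib_left)
    then show ?thesis by (simp add: bform_left bform_right)
  qed
  then show "z \<in> osp_part G i" using z unfolding osp_part_def by auto
qed

text \<open>The form is block diagonal, with a symmetric invertible block on \<open>V\<^sub>0\<close> and a skew block
  on \<open>V\<^sub>1\<close>.\<close>
lemma supersym_form_blocks:
  assumes "supersym_form G"
  shows "G = block (block00 G) 0 0 (block11 G)" and "transpose (block00 G) = block00 G"
    and "transpose (block11 G) = - block11 G" and "invertible (block00 G)"
proof -
  have off: "\<forall>r c. par r \<noteq> par c \<longrightarrow> G$r$c = 0"
    and sym: "\<forall>i j. G$(Inl i)$(Inl j) = G$(Inl j)$(Inl i)"
    and skew: "\<forall>i j. G$(Inr i)$(Inr j) = - G$(Inr j)$(Inr i)"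
    using assms unfolding supersym_form_def by blast+
  show G: "G = block (block00 G) 0 0 (block11 G)"
    using off by (simp add: vec_eq_iff split_sum_all block00_def block11_def)
  show "transpose (block00 G) = block00 G"
    unfolding vec_eq_iff transpose_def block00_def using sym by simp
  show "transpose (block11 G) = - block11 G"
    using skew by (simp (no_asm_use) add: vec_eq_iff transpose_def block11_def) blast
  obtain H where H: "G ** H = mat 1" "H ** G = mat 1"
    using assms unfolding supersym_form_def invertible_def by blast
  have "block (block00 G) 0 0 (block11 G) ** block (block00 H) (block01 H) (block10 H) (block11 H)
        = block (mat 1) 0 0 (mat 1)"
    and "block (block00 H) (block01 H) (block10 H) (block11 H) ** block (block00 G) 0 0 (block11 G)
        = block (mat 1) 0 0 (mat 1)"
    unfolding G[symmetric] block_decompose[of H, symmetric] block_mat_1[symmetric] by (fact H)+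
  then have "block00 G ** block00 H = mat 1 \<and> block00 H ** block00 G = mat 1"
    unfolding block_mult block_eq_iff by simp
  then show "invertible (block00 G)" unfolding invertible_def by blast
qed

text \<open>An even element of \<open>osp\<close> is block diagonal, each block skew-adjoint for the form.\<close>
lemma osp_even_blocks:
  assumes G: "G = block G0 0 0 G1" and e: "e \<in> osp_part G 0"
  shows "e = block (block00 e) 0 0 (block11 e)"
    and "transpose (block00 e) ** G0 = - (G0 ** block00 e)"
    and "transpose (block11 e) ** G1 = - (G1 ** block11 e)"
proof -
  show eb: "e = block (block00 e) 0 0 (block11 e)"
    using e gl_part_even_iff by (auto simp: osp_part_def)
  have "transpose e ** G = - (G ** e)" using e by (simp add: osp_part_iff vec_eq_iff)
  then have "block (transpose (block00 e) ** G0) 0 0 (transpose (block11 e) ** G1)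
      = block (- (G0 ** block00 e)) 0 0 (- (G1 ** block11 e))"
    by (subst (asm) eb, subst (asm) eb) (simp add: G block_transpose block_mult block_uminus)
  then show "transpose (block00 e) ** G0 = - (G0 ** block00 e)"
    and "transpose (block11 e) ** G1 = - (G1 ** block11 e)"
    by (simp_all add: block_eq_iff)
qed

text \<open>An odd block matrix supercommutes with a block diagonal one iff its two blocks intertwine
  the diagonal blocks.\<close>
lemma odd_block_centralizes_iff:
  "sbracket 0 1 (block e0 0 0 e1) (block 0 C B 0) = 0 \<longleftrightarrow>
     B \<in> intertwiners e0 e1 \<and> C \<in> intertwiners e1 e0"
  by (auto simp: sbracket_def block_mult block_minus block_zero block_eq_iff intertwiners_def)

section \<open>Dimensions of odd centralizers\<close>

text \<open>Injective linear maps between matrix spaces preserve dimension.\<close>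
lemma dim_injective_image:
  assumes "Vector_Spaces.linear mscale mscale (f :: 'k::field^'n::finite^'m::finite \<Rightarrow> 'k^'n2::finite^'m2::finite)"
    and "inj f"
  shows "mat.dim (f ` S) = mat.dim S"
  using mat.dim_image_eq[OF assms(1)] assms(2) by (simp add: inj_on_subset)

text \<open>In \<open>gl(m|2n)\<close> the odd centralizer of a block diagonal \<open>e\<close> is the direct sum of the
  intertwiners in both directions.\<close>
lemma dim_odd_centralizer_gl:
  fixes e0 :: "complex^'a::finite^'a" and e1 :: "complex^'b::finite^'b"
  shows "mat.dim (odd_centralizer (block e0 0 0 e1) (gl_part 1))
           = mat.dim (intertwiners e0 e1) + mat.dim (intertwiners e1 e0)"
proof -
  define lower where "lower B = block 0 0 B 0" for B :: "complex^'a^'b"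
  define upper where "upper C = block 0 C 0 0" for C :: "complex^'b^'a"
  have lin: "Vector_Spaces.linear mscale mscale lower" "Vector_Spaces.linear mscale mscale upper"
    unfolding Vector_Spaces.linear_iff lower_def upper_def
    by (simp_all add: mat.vector_space_axioms block_add block_mscale block_zero)
  have inj: "inj lower" "inj upper"
    unfolding inj_def lower_def upper_def by (simp_all add: block_eq_iff)
  let ?X = "lower ` intertwiners e0 e1" and ?Y = "upper ` intertwiners e1 e0"
  have "odd_centralizer (block e0 0 0 e1) (gl_part 1) = {x + y |x y. x \<in> ?X \<and> y \<in> ?Y}"
  proof (intro equalityI subsetI)
    fix z assume "z \<in> odd_centralizer (block e0 0 0 e1) (gl_part 1)"
    then have odd: "z \<in> gl_part 1" and comm: "sbracket 0 1 (block e0 0 0 e1) z = 0"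
      by (simp_all add: odd_centralizer_def)
    obtain B C where zb: "z = block 0 C B 0" using odd gl_part_odd_iff by blast
    have "B \<in> intertwiners e0 e1" "C \<in> intertwiners e1 e0"
      using comm unfolding zb odd_block_centralizes_iff by simp_all
    with zb show "z \<in> {x + y |x y. x \<in> ?X \<and> y \<in> ?Y}"
      unfolding lower_def upper_def by (force simp: block_add)
  next
    fix z assume "z \<in> {x + y |x y. x \<in> ?X \<and> y \<in> ?Y}"
    then obtain B C where BC: "B \<in> intertwiners e0 e1" "C \<in> intertwiners e1 e0"
      and zb: "z = block 0 C B 0"
      by (auto simp: lower_def upper_def block_add)
    have "block 0 C B 0 \<in> gl_part 1" unfolding gl_part_odd_iff by simp
    moreover have "sbracket 0 1 (block e0 0 0 e1) (block 0 C B 0) = 0"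
      unfolding odd_block_centralizes_iff using BC by blast
    ultimately show "z \<in> odd_centralizer (block e0 0 0 e1) (gl_part 1)"
      unfolding odd_centralizer_def zb by blast
  qed
  moreover have "?X \<inter> ?Y = {0}"
  proof -
    have "lower 0 = 0" "upper 0 = 0" by (simp_all add: lower_def upper_def block_zero)
    then have "0 \<in> ?X \<inter> ?Y" using intertwiners_subspace[THEN mat.subspace_0] by (metis IntI image_eqI)
    moreover have "?X \<inter> ?Y \<subseteq> {0}" by (auto simp: lower_def upper_def block_eq_iff block_zero)
    ultimately show ?thesis by blast
  qed
  ultimately show ?thesis
    using mat.dim_sums_Int[OF mat.linear_subspace_image[OF lin(1) intertwiners_subspace[of e0 e1]]
        mat.linear_subspace_image[OF lin(2) intertwiners_subspace[of e1 e0]]]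
    by (simp add: dim_injective_image[OF lin(1) inj(1)] dim_injective_image[OF lin(2) inj(2)])
qed

text \<open>From now on the form has a symmetric block \<open>G0\<close> with inverse \<open>P\<close> and a skew block \<open>G1\<close>.\<close>
locale osp_form =
  fixes G0 :: "complex^'a::finite^'a" and G1 :: "complex^'b::finite^'b" and P :: "complex^'a^'a"
  assumes G0_sym: "transpose G0 = G0" and G1_skew: "transpose G1 = - G1"
    and P_left: "P ** G0 = mat 1" and P_right: "G0 ** P = mat 1"
begin

text \<open>An odd element of \<open>osp\<close> is determined by its block \<open>B : V\<^sub>0 \<rightarrow> V\<^sub>1\<close>; the other block is
  \<open>-G0\<^sup>-\<^sup>1 B\<^sup>T G1\<close>.\<close>
lemma osp_odd_block_iff:
  "block 0 C B 0 \<in> osp_part (block G0 0 0 G1) 1 \<longleftrightarrow> C = - (P ** transpose B ** G1)"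
proof -
  have "block 0 C B 0 \<in> osp_part (block G0 0 0 G1) 1 \<longleftrightarrow>
      transpose B ** G1 = - (G0 ** C) \<and> transpose C ** G0 = G1 ** B"
    using gl_part_odd_iff[of "block 0 C B 0"]
    by (simp add: osp_part_iff block_transpose block_mult vec_eq_iff split_sum_all)
  also have "\<dots> \<longleftrightarrow> C = - (P ** transpose B ** G1)"
  proof
    assume "transpose B ** G1 = - (G0 ** C) \<and> transpose C ** G0 = G1 ** B"
    then have "P ** (transpose B ** G1) = - (P ** G0 ** C)"
      by (simp add: mult_uminus_right matrix_mul_assoc)
    then show "C = - (P ** transpose B ** G1)" by (simp add: P_left matrix_mul_assoc)
  next
    assume C: "C = - (P ** transpose B ** G1)"
    have "transpose P ** G0 = mat 1"
      using P_right G0_sym by (metis matrix_transpose_mul transpose_mat)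
    moreover have "transpose C = G1 ** B ** transpose P"
      by (simp add: C transpose_uminus matrix_transpose_mul G1_skew mult_uminus_left matrix_mul_assoc)
    ultimately have "transpose C ** G0 = G1 ** B" by (simp flip: matrix_mul_assoc)
    moreover have "transpose B ** G1 = - (G0 ** C)"
      by (simp add: C mult_uminus_right matrix_mul_assoc P_right)
    ultimately show "transpose B ** G1 = - (G0 ** C) \<and> transpose C ** G0 = G1 ** B" by simp
  qed
  finally show ?thesis .
qed

text \<open>If \<open>e0, e1\<close> are skew-adjoint, the map \<open>B \<mapsto> -G0\<^sup>-\<^sup>1 B\<^sup>T G1\<close> (an adjoint) turns
  intertwiners \<open>e0 \<rightarrow> e1\<close> into intertwiners \<open>e1 \<rightarrow> e0\<close>.\<close>
lemma adjoint_intertwines: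
  assumes e0: "transpose e0 ** G0 = - (G0 ** e0)" and e1: "transpose e1 ** G1 = - (G1 ** e1)"
    and B: "B \<in> intertwiners e0 e1"
  shows "- (P ** transpose B ** G1) \<in> intertwiners e1 e0"
proof -
  have Pe0: "P ** transpose e0 = - (e0 ** P)"
  proof -
    have "P ** transpose e0 = P ** (transpose e0 ** G0) ** P"
      by (simp add: P_right flip: matrix_mul_assoc)
    also have "\<dots> = - (e0 ** P)"
      by (simp add: e0 mult_uminus_left mult_uminus_right matrix_mul_assoc P_left)
    finally show ?thesis .
  qed
  have Be0: "B ** e0 = e1 ** B" using B by (simp add: intertwiners_def)
  have "e0 ** - (P ** transpose B ** G1) = P ** transpose (B ** e0) ** G1"
    by (simp add: mult_uminus_right matrix_transpose_mul matrix_mul_assoc Pe0 mult_uminus_left)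
  also have "\<dots> = P ** transpose B ** (transpose e1 ** G1)"
    by (simp add: Be0 matrix_transpose_mul matrix_mul_assoc)
  also have "\<dots> = - (P ** transpose B ** G1) ** e1"
    by (simp add: e1 mult_uminus_left mult_uminus_right matrix_mul_assoc)
  finally show ?thesis by (simp add: intertwiners_def)
qed

text \<open>In \<open>osp\<close> the odd centralizer of a block diagonal, skew-adjoint \<open>e\<close> is isomorphic to the
  intertwiners \<open>e0 \<rightarrow> e1\<close>.\<close>
lemma dim_odd_centralizer_osp:
  assumes e0: "transpose e0 ** G0 = - (G0 ** e0)" and e1: "transpose e1 ** G1 = - (G1 ** e1)"
  shows "mat.dim (odd_centralizer (block e0 0 0 e1) (osp_part (block G0 0 0 G1) 1))
           = mat.dim (intertwiners e0 e1)"
proof -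
  define lift where "lift B = block 0 (- (P ** transpose B ** G1)) B 0" for B :: "complex^'a^'b"
  have "odd_centralizer (block e0 0 0 e1) (osp_part (block G0 0 0 G1) 1) = lift ` intertwiners e0 e1"
  proof (intro equalityI subsetI)
    fix z assume "z \<in> odd_centralizer (block e0 0 0 e1) (osp_part (block G0 0 0 G1) 1)"
    then have osp: "z \<in> osp_part (block G0 0 0 G1) 1" and comm: "sbracket 0 1 (block e0 0 0 e1) z = 0"
      by (simp_all add: odd_centralizer_def)
    obtain B C where zb: "z = block 0 C B 0"
      using osp gl_part_odd_iff unfolding osp_part_def by blast
    have "C = - (P ** transpose B ** G1)" "B \<in> intertwiners e0 e1"
      using osp comm unfolding zb osp_odd_block_iff odd_block_centralizes_iff by simp_all
    with zb show "z \<in> lift ` intertwiners e0 e1" unfolding lift_def by force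
  next
    fix z assume "z \<in> lift ` intertwiners e0 e1"
    then obtain B where B: "B \<in> intertwiners e0 e1" and zb: "z = lift B" by blast
    have "lift B \<in> osp_part (block G0 0 0 G1) 1" unfolding lift_def osp_odd_block_iff by (rule refl)
    moreover have "sbracket 0 1 (block e0 0 0 e1) (lift B) = 0"
      unfolding lift_def odd_block_centralizes_iff using B adjoint_intertwines[OF e0 e1] by blast
    ultimately show "z \<in> odd_centralizer (block e0 0 0 e1) (osp_part (block G0 0 0 G1) 1)"
      unfolding odd_centralizer_def zb by blast
  qed
  moreover have "Vector_Spaces.linear mscale mscale lift"
    unfolding Vector_Spaces.linear_iff lift_def
    by (simp add: mat.vector_space_axioms block_add block_mscale transpose_add transpose_mscale
        matrix_add_ldistrib matrix_add_rdistrib mscale_mult_left mscale_mult_right)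
  moreover have "inj lift" unfolding inj_def lift_def by (simp add: block_eq_iff)
  ultimately show ?thesis by (simp add: dim_injective_image)
qed

end

section \<open>The main theorem\<close>

theorem mainTheorem5:
  fixes G e :: "complex^('a::finite + 'b::finite)^('a + 'b)"
    and p q :: "nat list"
  assumes "supersym_form G"
    and "e \<in> osp_part G 0"
    and "nilpotent_mat e"
    and "jordan_type (blk0 e) p"
    and "jordan_type (blk1 e) q"
  shows "mat.dim (odd_centralizer e (osp_part G 1))
           = (\<Sum>i<length p. \<Sum>j<length q. min (p!i) (q!j))
      \<and> 2 * mat.dim (odd_centralizer e (osp_part G 1))
           = mat.dim (odd_centralizer e (gl_part 1 :: (complex^('a+'b)^('a+'b)) set))"
proof -
  define G0 G1 e0 e1 where "G0 = block00 G" and "G1 = block11 G"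
    and "e0 = block00 e" and "e1 = block11 e"
  note parts = G0_def G1_def e0_def e1_def
  have G: "G = block G0 0 0 G1" and G0: "transpose G0 = G0" "invertible G0"
    and G1: "transpose G1 = - G1"
    using supersym_form_blocks[OF assms(1)] by (simp_all add: parts)
  then obtain P where "P ** G0 = mat 1" "G0 ** P = mat 1" unfolding invertible_def by blast
  with G0 G1 interpret osp_form G0 G1 P by unfold_locales
  have e: "e = block e0 0 0 e1"
    and skew: "transpose e0 ** G0 = - (G0 ** e0)" "transpose e1 ** G1 = - (G1 ** e1)"
    using osp_even_blocks[OF G assms(2)] by (simp_all add: parts)
  obtain v w where v: "jordan_basis e0 p v" and w: "jordan_basis e1 q w"
    using assms(4,5) jordan_type_imp_basis unfolding blk0_eq_block00 blk1_eq_block11 parts by metis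
  have pos: "\<forall>x\<in>set p. 0 < x" "\<forall>x\<in>set q. 0 < x"
    using assms(4,5) unfolding jordan_type_def by blast+
  have "mat.dim (intertwiners e0 e1) = (\<Sum>i<length p. \<Sum>j<length q. min (p!i) (q!j))"
    using jordan_pair.dim_intertwiners[OF jordan_pair.intro[OF v w pos(1)]] .
  moreover have "mat.dim (intertwiners e1 e0) = (\<Sum>i<length p. \<Sum>j<length q. min (p!i) (q!j))"
    using jordan_pair.dim_intertwiners[OF jordan_pair.intro[OF w v pos(2)]]
    by (simp add: sum.swap[of _ "{..<length q}"] min.commute)
  ultimately show ?thesis
    unfolding e G using dim_odd_centralizer_osp[OF skew] dim_odd_centralizer_gl[of e0 e1] by simp
qed

end
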